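(* The smallest order of a ring that is NI, reflexive and not abelian is $64$. An example of an NI nonabelian reflexive ring of order $64$ is the additive group $$R=\frac{\mathbb{F}_2[x]}{\langle x^2\rangle}\oplus\frac{\mathbb{F}_2[x]}{\langle x^2\rangle}\oplus\mathbb{F}_2\oplus\mathbb{F}_2$$ with multiplication $$(\alpha_1+\beta_1x,\ \gamma_1+\delta_1x,\ \epsilon_1,\ \zeta_1)\,(\alpha_2+\beta_2x,\ \gamma_2+\delta_2x,\ \epsilon_2,\ \zeta_2)$$ $$=\big(\epsilon_1\zeta_2x+(\alpha_1+\beta_1x)(\alpha_2+\beta_2x),\ \ \epsilon_2\zeta_1x+(\gamma_1+\delta_1x)(\gamma_2+\delta_2x),\ \ \alpha_1\epsilon_2+\gamma_2\epsilon_1,\ \ \gamma_1\zeta_2+\alpha_2\zeta_1\big)$$ for $\alpha_j,\beta_j,\gamma_j,\delta_j,\epsilon_j,\zeta_j\in\mathbb{F}_2$, with identity $(1,1,0,0)$.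
   Context: All rings are associative with unity. A ring $R$ is NI if its set $N(R)$ of nilpotent elements is a two-sided ideal (equivalently, $N(R)$ equals the upper nil radical of $R$); abelian if each idempotent of $R$ is central; reflexive if for all $a,b\in R$, $aRb=0$ implies $bRa=0$. *)

theory Defs
  imports
    "HOL-Algebra.Algebraic_Closure_Type"
    "HOL-Algebra.Chinese_Remainder"
    "HOL-Library.Z2"
begin

definition nilpotents :: "('a, 'm) ring_scheme \<Rightarrow> 'a set" where
  "nilpotents R = {x \<in> carrier R. \<exists>n::nat. x [^]\<^bsub>R\<^esub> n = \<zero>\<^bsub>R\<^esub>}"

definition NI_ring :: "('a, 'm) ring_scheme \<Rightarrow> bool" where
  "NI_ring R \<longleftrightarrow> ideal (nilpotents R) R"

(* Not to be confused with the library's abelian_group, abelian_monoid: here every idempotent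
   is central. *)
definition abelian_ring :: "('a, 'm) ring_scheme \<Rightarrow> bool" where
  "abelian_ring R \<longleftrightarrow>
     (\<forall>e\<in>carrier R. e \<otimes>\<^bsub>R\<^esub> e = e \<longrightarrow> (\<forall>r\<in>carrier R. e \<otimes>\<^bsub>R\<^esub> r = r \<otimes>\<^bsub>R\<^esub> e))"

definition reflexive_ring :: "('a, 'm) ring_scheme \<Rightarrow> bool" where
  "reflexive_ring R \<longleftrightarrow>
     (\<forall>a\<in>carrier R. \<forall>b\<in>carrier R.
        (\<forall>r\<in>carrier R. a \<otimes>\<^bsub>R\<^esub> r \<otimes>\<^bsub>R\<^esub> b = \<zero>\<^bsub>R\<^esub>) \<longrightarrow>
        (\<forall>r\<in>carrier R. b \<otimes>\<^bsub>R\<^esub> r \<otimes>\<^bsub>R\<^esub> a = \<zero>\<^bsub>R\<^esub>))"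

definition F2 :: "bit ring" where
  "F2 = ring_of_type_algebra"

definition F2_poly :: "bit poly ring" where
  "F2_poly = ring_of_type_algebra"

(* The ring F_2[x]/<x^2>; its elements are cosets, i.e. sets of polynomials. *)
definition F2_dual :: "bit poly set ring" where
  "F2_dual = F2_poly Quot (PIdl\<^bsub>F2_poly\<^esub> [:0, 0, 1:])"

(* The residue class of a + b x. *)
definition dual :: "bit \<Rightarrow> bit \<Rightarrow> bit poly set" where
  "dual a b = (PIdl\<^bsub>F2_poly\<^esub> [:0, 0, 1:]) +>\<^bsub>F2_poly\<^esub> [:a, b:]"

(* The coefficient a of a residue class written as a + b x. *)
definition dual_const :: "bit poly set \<Rightarrow> bit" where
  "dual_const u = (THE a. \<exists>b. u = dual a b)"

(* The additive structure is that of the direct sum; multiplication and identity are replaced.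
   With u_j = alpha_j + beta_j x and v_j = gamma_j + delta_j x the product is the one of the
   statement, as lemma ex_ring_mult below confirms. *)
definition ex_ring :: "(bit poly set \<times> bit poly set \<times> bit \<times> bit) ring" where
  "ex_ring = (RDirProd F2_dual (RDirProd F2_dual (RDirProd F2 F2)))
     \<lparr> monoid.mult := (\<lambda>(u1, v1, e1, z1) (u2, v2, e2, z2).
         (dual 0 (e1 * z2) \<oplus>\<^bsub>F2_dual\<^esub> u1 \<otimes>\<^bsub>F2_dual\<^esub> u2,
          dual 0 (e2 * z1) \<oplus>\<^bsub>F2_dual\<^esub> v1 \<otimes>\<^bsub>F2_dual\<^esub> v2,
          dual_const u1 * e2 + dual_const v2 * e1,
          dual_const v1 * z2 + dual_const u2 * z1)),
       one := (\<one>\<^bsub>F2_dual\<^esub>, \<one>\<^bsub>F2_dual\<^esub>, 0, 0) \<rparr>"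

lemma carrier_F2_poly [simp]: "carrier F2_poly = UNIV"
  by (simp add: F2_poly_def ring_of_type_algebra_def)

lemma cring_F2_poly: "cring F2_poly"
  unfolding F2_poly_def by (rule cring_from_type_algebra)

lemma ex_multiple_x2:
  fixes p :: "'a :: comm_ring_1 poly"
  shows "(\<exists>q. p = q * [:0, 0, 1:] + [:a, b:]) \<longleftrightarrow> poly.coeff p 0 = a \<and> poly.coeff p 1 = b"
proof
  assume "poly.coeff p 0 = a \<and> poly.coeff p 1 = b"
  moreover obtain c d q where "p = pCons c (pCons d q)"
    by (metis pCons_cases)
  ultimately have "p = q * [:0, 0, 1:] + [:a, b:]" by simp
  then show "\<exists>q. p = q * [:0, 0, 1:] + [:a, b:]" ..
qed auto

lemma coeff_mult_linear:
  fixes a b c d :: "'a :: comm_ring_1"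
  shows "poly.coeff ([:a, b:] * [:c, d:]) 0 = a * c"
    and "poly.coeff ([:a, b:] * [:c, d:]) 1 = a * d + b * c"
  by simp_all

lemma image_translate:
  "(\<Union>h\<in>{f x | x. x \<in> UNIV}. {h + c}) = {p. \<exists>q. p = f q + c}"
  by auto

lemma dual_eq: "dual a b = {p. poly.coeff p 0 = a \<and> poly.coeff p 1 = b}"
proof -
  have "dual a b = {p. \<exists>q. p = q * [:0, 0, 1:] + [:a, b:]}"
    unfolding dual_def a_r_coset_def' cgenideal_def F2_poly_def ring_of_type_algebra_def
    unfolding ring.simps monoid.simps partial_object.simps
    by (rule image_translate)
  then show ?thesis by (simp only: ex_multiple_x2)
qed

lemma dual_eq_iff: "dual a b = dual c d \<longleftrightarrow> a = c \<and> b = d"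
proof
  assume "dual a b = dual c d"
  moreover have "[:a, b:] \<in> dual a b" by (simp add: dual_eq)
  ultimately show "a = c \<and> b = d" by (auto simp: dual_eq)
qed simp

lemma dual_const_dual [simp]: "dual_const (dual a b) = a"
  by (auto simp: dual_const_def dual_eq_iff)

lemma coset_eq_dual: "(PIdl\<^bsub>F2_poly\<^esub> [:0, 0, 1:]) +>\<^bsub>F2_poly\<^esub> p = dual (poly.coeff p 0) (poly.coeff p 1)"
proof -
  interpret cring F2_poly by (rule cring_F2_poly)
  interpret ideal "PIdl\<^bsub>F2_poly\<^esub> [:0, 0, 1:]" F2_poly by (rule cgenideal_ideal) simp
  have "p \<in> (PIdl\<^bsub>F2_poly\<^esub> [:0, 0, 1:]) +>\<^bsub>F2_poly\<^esub> [:poly.coeff p 0, poly.coeff p 1:]"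
    using dual_eq[of "poly.coeff p 0" "poly.coeff p 1"] by (simp add: dual_def)
  then show ?thesis
    unfolding dual_def by (rule a_repr_independence[symmetric, OF _ _ a_subgroup]) simp
qed

lemma carrier_F2_dual: "carrier F2_dual = {dual a b | a b. True}"
proof -
  have "\<exists>p. dual a b = dual (poly.coeff p 0) (poly.coeff p 1)" for a b
    by (rule exI[of _ "[:a, b:]"]) simp
  then show ?thesis
    by (auto simp: F2_dual_def FactRing_def A_RCOSETS_def' coset_eq_dual)
qed

lemma one_F2_dual: "\<one>\<^bsub>F2_dual\<^esub> = dual 1 0"
  by (simp add: F2_dual_def FactRing_def coset_eq_dual)
     (simp add: F2_poly_def ring_of_type_algebra_def)

lemma zero_F2_dual: "\<zero>\<^bsub>F2_dual\<^esub> = dual 0 0"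
proof -
  interpret cring F2_poly by (rule cring_F2_poly)
  interpret ideal "PIdl\<^bsub>F2_poly\<^esub> [:0, 0, 1:]" F2_poly by (rule cgenideal_ideal) simp
  have "dual 0 0 = (PIdl\<^bsub>F2_poly\<^esub> [:0, 0, 1:]) +>\<^bsub>F2_poly\<^esub> \<zero>\<^bsub>F2_poly\<^esub>"
    by (simp add: coset_eq_dual) (simp add: F2_poly_def ring_of_type_algebra_def)
  then show ?thesis by (simp add: F2_dual_def FactRing_def a_rcos_zero)
qed

lemma add_F2_dual: "dual a b \<oplus>\<^bsub>F2_dual\<^esub> dual c d = dual (a + c) (b + d)"
proof -
  interpret cring F2_poly by (rule cring_F2_poly)
  interpret ideal "PIdl\<^bsub>F2_poly\<^esub> [:0, 0, 1:]" F2_poly by (rule cgenideal_ideal) simp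
  have "dual a b \<oplus>\<^bsub>F2_dual\<^esub> dual c d
      = (PIdl\<^bsub>F2_poly\<^esub> [:0, 0, 1:]) +>\<^bsub>F2_poly\<^esub> ([:a, b:] \<oplus>\<^bsub>F2_poly\<^esub> [:c, d:])"
    by (simp add: F2_dual_def FactRing_def dual_def a_rcos_sum)
  also have "\<dots> = dual (a + c) (b + d)"
    by (simp only: coset_eq_dual) (simp add: F2_poly_def ring_of_type_algebra_def)
  finally show ?thesis .
qed

lemma mult_F2_dual: "dual a b \<otimes>\<^bsub>F2_dual\<^esub> dual c d = dual (a * c) (a * d + b * c)"
proof -
  interpret cring F2_poly by (rule cring_F2_poly)
  interpret ideal "PIdl\<^bsub>F2_poly\<^esub> [:0, 0, 1:]" F2_poly by (rule cgenideal_ideal) simp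
  have "dual a b \<otimes>\<^bsub>F2_dual\<^esub> dual c d
      = (PIdl\<^bsub>F2_poly\<^esub> [:0, 0, 1:]) +>\<^bsub>F2_poly\<^esub> ([:a, b:] \<otimes>\<^bsub>F2_poly\<^esub> [:c, d:])"
    by (simp add: F2_dual_def FactRing_def dual_def rcoset_mult_add)
  also have "\<dots> = dual (a * c) (a * d + b * c)"
    by (simp only: coset_eq_dual) (simp only: F2_poly_def ring_of_type_algebra_def monoid.simps
        coeff_mult_linear)
  finally show ?thesis .
qed

lemma product_image:
  "{f a b | a b. True} \<times> {f c d | c d. True} \<times> UNIV \<times> UNIV
     = {(f a b, f c d, e, z) | a b c d e z. True}"
  by blast

lemma ex_ring_carrier:
  "carrier ex_ring = {(dual a b, dual c d, e, z) | a b c d e z. True}"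
proof -
  have "carrier ex_ring = {dual a b | a b. True} \<times> {dual c d | c d. True} \<times> UNIV \<times> UNIV"
    by (simp add: ex_ring_def RDirProd_carrier carrier_F2_dual F2_def ring_of_type_algebra_def)
  also have "\<dots> = {(dual a b, dual c d, e, z) | a b c d e z. True}"
    by (rule product_image)
  finally show ?thesis .
qed

lemma ex_ring_zero: "\<zero>\<^bsub>ex_ring\<^esub> = (dual 0 0, dual 0 0, 0, 0)"
  by (simp add: ex_ring_def RDirProd_def DirProd_def monoid.defs zero_F2_dual F2_def
      ring_of_type_algebra_def)

lemma ex_ring_add:
  "(dual a1 b1, dual c1 d1, e1, z1) \<oplus>\<^bsub>ex_ring\<^esub> (dual a2 b2, dual c2 d2, e2, z2)
     = (dual (a1 + a2) (b1 + b2), dual (c1 + c2) (d1 + d2), e1 + e2, z1 + z2)"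
  by (simp add: ex_ring_def RDirProd_def DirProd_def monoid.defs add_F2_dual F2_def
      ring_of_type_algebra_def)

lemma ex_ring_mult:
  "(dual a1 b1, dual c1 d1, e1, z1) \<otimes>\<^bsub>ex_ring\<^esub> (dual a2 b2, dual c2 d2, e2, z2)
     = (dual 0 (e1 * z2) \<oplus>\<^bsub>F2_dual\<^esub> dual a1 b1 \<otimes>\<^bsub>F2_dual\<^esub> dual a2 b2,
        dual 0 (e2 * z1) \<oplus>\<^bsub>F2_dual\<^esub> dual c1 d1 \<otimes>\<^bsub>F2_dual\<^esub> dual c2 d2,
        a1 * e2 + c2 * e1,
        c1 * z2 + a2 * z1)"
  by (simp add: ex_ring_def)

end

theory Submission
  imports Defs
begin

text \<open>
  If \<open>e\<close> is a non-central idempotent and \<open>f = 1 - e\<close>, then one of the Peirce corners \<open>eRf\<close>,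
  \<open>fRe\<close> is nonzero; say \<open>0 \<noteq> m \<in> eRf\<close>. As \<open>eRm\<close> and \<open>mRf\<close> contain \<open>m\<close>, reflexivity gives
  nonzero elements \<open>x \<in> mRe\<close> and \<open>y \<in> fRm\<close>, and the former forces \<open>fRe \<noteq> 0\<close>. Since \<open>m\<^sup>2 = 0\<close>
  and \<open>R\<close> is NI, \<open>x\<close> and \<open>y\<close> are nilpotent, so \<open>0, e, x, e + x\<close> are distinct in \<open>eRe\<close> and
  \<open>0, f, y, f + y\<close> are distinct in \<open>fRf\<close>. By the Peirce decomposition \<open>|R| \<ge> 4 * 2 * 2 * 4\<close>.
\<close>

section \<open>The lower bound\<close>

text \<open>Every positive power of \<open>e\<close> is \<open>e\<close> itself. This keeps a
  nonzero idempotent outside the ideal of nilpotents.\<close>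

lemma (in ring) idempotent_nilpotent_eq_zero:
  assumes e: "e \<in> carrier R" "e \<otimes> e = e" and nil: "e \<in> nilpotents R"
  shows "e = \<zero>"
proof -
  obtain n :: nat where n: "e [^] n = \<zero>"
    using nil by (auto simp: nilpotents_def)
  have "e [^] Suc k = e" for k
    using e by (induction k) auto
  \<comment> \<open>The exponent \<open>n\<close> may be 0, so the vanishing power is multiplied by
    \<open>e\<close> once more.\<close>
  then have "e = e [^] n \<otimes> e" by simp
  then show ?thesis using n e by simp
qed

text \<open>A coincidence \<open>e = x\<close> or \<open>e = -x\<close> would put the idempotent
  \<open>e\<close> into the ideal of nilpotents; all other coincidences are excluded by
  cancellation.\<close>

lemma (in ring) four_le_card_corner:
  assumes e: "e \<in> carrier R" "e \<otimes> e = e" "e \<noteq> \<zero>"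
    and x: "x \<in> nilpotents R" "x \<noteq> \<zero>"
    and NI: "NI_ring R"
  shows "card {\<zero>, e, x, e \<oplus> x} = 4"
proof -
  interpret N: ideal "nilpotents R" R using NI by (simp add: NI_ring_def)
  have xc: "x \<in> carrier R" using x unfolding nilpotents_def by blast
  have "e \<notin> nilpotents R" using e idempotent_nilpotent_eq_zero by blast
  then have "e \<noteq> x" "e \<oplus> x \<noteq> \<zero>"
    using x(1) e(1) xc N.a_inv_closed[OF x(1)] minus_equality[of e x] by metis+
  moreover have "e \<oplus> x \<noteq> e" "e \<oplus> x \<noteq> x" using e x xc by auto
  ultimately show ?thesis using e x by auto
qed

lemma (in ring) reflexive_ringD:
  assumes "reflexive_ring R" "a \<in> carrier R" "b \<in> carrier R" "r \<in> carrier R" "a \<otimes> r \<otimes> b \<noteq> \<zero>"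
  obtains s where "s \<in> carrier R" "b \<otimes> s \<otimes> a \<noteq> \<zero>"
  using assms unfolding reflexive_ring_def by blast

text \<open>\<open>A\<close>, \<open>M\<close>, \<open>L\<close>, \<open>B\<close> are arbitrary
  subsets of the corners eRe, eRf, fRe, fRf, membership being expressed by invariance under the
  idempotents on both sides. A sum of four such components determines each of them, so summation is
  injective.\<close>

lemma (in ring) peirce_card_le_order:
  assumes fin: "finite (carrier R)" and c: "e \<in> carrier R" "f \<in> carrier R"
    and idem: "e \<otimes> e = e" "f \<otimes> f = f" and orth: "e \<otimes> f = \<zero>" "f \<otimes> e = \<zero>"
    and A: "\<And>a. a \<in> A \<Longrightarrow> a \<in> carrier R \<and> e \<otimes> a = a \<and> a \<otimes> e = a"
    and M: "\<And>a. a \<in> M \<Longrightarrow> a \<in> carrier R \<and> e \<otimes> a = a \<and> a \<otimes> f = a"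
    and L: "\<And>a. a \<in> L \<Longrightarrow> a \<in> carrier R \<and> f \<otimes> a = a \<and> a \<otimes> e = a"
    and B: "\<And>a. a \<in> B \<Longrightarrow> a \<in> carrier R \<and> f \<otimes> a = a \<and> a \<otimes> f = a"
  shows "card A * (card M * (card L * card B)) \<le> Coset.order R"
proof -
  let ?\<phi> = "\<lambda>(a, m, l, b). a \<oplus> m \<oplus> l \<oplus> b"
  \<comment> \<open>For instance \<open>e a = a\<close> gives \<open>f a = (f e) a = 0\<close> by
    orthogonality.\<close>
  have kill:
    "e \<otimes> a = a \<Longrightarrow> f \<otimes> a = \<zero>" "f \<otimes> a = a \<Longrightarrow> e \<otimes> a = \<zero>"
    "a \<otimes> e = a \<Longrightarrow> a \<otimes> f = \<zero>" "a \<otimes> f = a \<Longrightarrow> a \<otimes> e = \<zero>"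
    if a: "a \<in> carrier R" for a
    using m_assoc[OF c(2,1) a] m_assoc[OF c a] m_assoc[OF a c] m_assoc[OF a c(2,1)]
      l_null[OF a] r_null[OF a] by (simp_all only: orth)
  \<comment> \<open>Multiplying by \<open>e\<close> or \<open>f\<close> on each side projects the
    sum onto one corner; \<open>kill\<close> removes the other three terms.\<close>
  have parts:
    "e \<otimes> (a \<oplus> m \<oplus> l \<oplus> b) \<otimes> e = a" "e \<otimes> (a \<oplus> m \<oplus> l \<oplus> b) \<otimes> f = m"
    "f \<otimes> (a \<oplus> m \<oplus> l \<oplus> b) \<otimes> e = l" "f \<otimes> (a \<oplus> m \<oplus> l \<oplus> b) \<otimes> f = b"
    if "a \<in> A" "m \<in> M" "l \<in> L" "b \<in> B" for a m l b
  proof -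
    note * = A[OF that(1)] M[OF that(2)] L[OF that(3)] B[OF that(4)]
    have "f \<otimes> a = \<zero>" "a \<otimes> f = \<zero>" "f \<otimes> m = \<zero>" "m \<otimes> e = \<zero>"
      "e \<otimes> l = \<zero>" "l \<otimes> f = \<zero>" "e \<otimes> b = \<zero>" "b \<otimes> e = \<zero>"
      using * kill by blast+
    then show "e \<otimes> (a \<oplus> m \<oplus> l \<oplus> b) \<otimes> e = a" "e \<otimes> (a \<oplus> m \<oplus> l \<oplus> b) \<otimes> f = m"
      "f \<otimes> (a \<oplus> m \<oplus> l \<oplus> b) \<otimes> e = l" "f \<otimes> (a \<oplus> m \<oplus> l \<oplus> b) \<otimes> f = b"
      using * c by (simp_all add: l_distr r_distr)
  qed
  have "inj_on ?\<phi> (A \<times> M \<times> L \<times> B)"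
  proof (rule inj_onI)
    fix p q assume *: "p \<in> A \<times> M \<times> L \<times> B" "q \<in> A \<times> M \<times> L \<times> B"
      "?\<phi> p = ?\<phi> q"
    obtain a m l b a' m' l' b' where p: "p = (a, m, l, b)" and q: "q = (a', m', l', b')"
      by (metis prod_cases4)
    then have "a \<oplus> m \<oplus> l \<oplus> b = a' \<oplus> m' \<oplus> l' \<oplus> b'" using * by simp
    then show "p = q"
      using parts[of a m l b] parts[of a' m' l' b'] * p q by simp
  qed
  moreover have "?\<phi> ` (A \<times> M \<times> L \<times> B) \<subseteq> carrier R" using A M L B by auto
  \<comment> \<open>Finiteness enters here: \<open>card\<close> assigns 0 to an infinite
    carrier.\<close>
  ultimately have "card (A \<times> M \<times> L \<times> B) \<le> card (carrier R)"
    using fin by (rule card_inj_on_le)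
  then show ?thesis by (simp add: card_cartesian_product Coset.order_def)
qed

text \<open>The hypotheses treat \<open>e\<close> and \<open>f\<close> symmetrically except for
  \<open>nz\<close>, so a nonzero element of the opposite corner is handled by exchanging
  them.\<close>

lemma (in ring) order_ge_64_if_corner:
  assumes fin: "finite (carrier R)" and NI: "NI_ring R" and refl: "reflexive_ring R"
    and c: "e \<in> carrier R" "f \<in> carrier R" "r \<in> carrier R"
    and idem: "e \<otimes> e = e" "f \<otimes> f = f" and orth: "e \<otimes> f = \<zero>" "f \<otimes> e = \<zero>"
    and nz: "e \<otimes> r \<otimes> f \<noteq> \<zero>"
  shows "64 \<le> Coset.order R"
proof -
  interpret N: ideal "nilpotents R" R using NI by (simp add: NI_ring_def)
  have idem': "e \<otimes> (e \<otimes> a) = e \<otimes> a" "f \<otimes> (f \<otimes> a) = f \<otimes> a"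
    and orth': "e \<otimes> (f \<otimes> a) = \<zero>" "f \<otimes> (e \<otimes> a) = \<zero>" if "a \<in> carrier R" for a
    using that c idem orth by (simp_all add: m_assoc[symmetric])
  define m where "m = e \<otimes> r \<otimes> f"
  have m: "m \<in> carrier R" "e \<otimes> m = m" "m \<otimes> f = m" "m \<otimes> m = \<zero>" "m \<noteq> \<zero>"
    using c nz by (simp_all add: m_def m_assoc idem idem' orth orth')
  have "m [^] (2::nat) = \<zero>" using m by (simp add: numeral_2_eq_2)
  then have mN: "m \<in> nilpotents R" using m(1) unfolding nilpotents_def by blast
  \<comment> \<open>The middle factor 1 already shows that eRm and mRf are nonzero; reflexivity
    reverses the outer factors.\<close>
  have "e \<otimes> \<one> \<otimes> m \<noteq> \<zero>" "m \<otimes> \<one> \<otimes> f \<noteq> \<zero>" using m c by auto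
  then obtain s t where s: "s \<in> carrier R" "m \<otimes> s \<otimes> e \<noteq> \<zero>"
    and t: "t \<in> carrier R" "f \<otimes> t \<otimes> m \<noteq> \<zero>"
    using reflexive_ringD[OF refl] m c by (metis one_closed)
  define x where "x = m \<otimes> s \<otimes> e"
  define y where "y = f \<otimes> t \<otimes> m"
  define l where "l = f \<otimes> s \<otimes> e"
  have x: "x \<in> nilpotents R" "x \<in> carrier R" "x \<noteq> \<zero>" "e \<otimes> x = x" "x \<otimes> e = x"
    using s c m mN by (auto simp: x_def m_assoc idem N.I_r_closed)
      (simp add: m_assoc[symmetric] m)
  have y: "y \<in> nilpotents R" "y \<in> carrier R" "y \<noteq> \<zero>" "f \<otimes> y = y" "y \<otimes> f = y"
    using t c m mN by (auto simp: y_def m_assoc idem' N.I_l_closed)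
  have l: "l \<in> carrier R" "f \<otimes> l = l" "l \<otimes> e = l"
    using s c by (auto simp: l_def m_assoc idem idem')
  \<comment> \<open>As \<open>m f = m\<close>, multiplying \<open>l\<close> by \<open>m\<close>
    gives \<open>m s e\<close>. Hence \<open>l\<close> is a nonzero element of fRe.\<close>
  have "m \<otimes> l = x"
    using s c m by (simp add: x_def l_def m_assoc[symmetric])
  then have l0: "l \<noteq> \<zero>" using x m by auto
  have ef: "e \<noteq> \<zero>" "f \<noteq> \<zero>" using m by auto
  let ?A = "{\<zero>, e, x, e \<oplus> x}" and ?B = "{\<zero>, f, y, f \<oplus> y}"
  have "card ?A = 4" "card ?B = 4"
    using four_le_card_corner[OF c(1) idem(1) ef(1) x(1,3) NI]
      four_le_card_corner[OF c(2) idem(2) ef(2) y(1,3) NI] .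
  moreover have "card {\<zero>, m} = 2" "card {\<zero>, l} = 2" using m l0 by auto
  moreover have "card ?A * (card {\<zero>, m} * (card {\<zero>, l} * card ?B)) \<le> Coset.order R"
  proof (rule peirce_card_le_order[OF fin c(1,2) idem orth])
    fix a show "a \<in> ?A \<Longrightarrow> a \<in> carrier R \<and> e \<otimes> a = a \<and> a \<otimes> e = a"
      by (elim insertE emptyE) (use c(1) idem x in \<open>simp_all add: l_distr r_distr\<close>)
    show "a \<in> ?B \<Longrightarrow> a \<in> carrier R \<and> f \<otimes> a = a \<and> a \<otimes> f = a"
      by (elim insertE emptyE) (use c(2) idem y in \<open>simp_all add: l_distr r_distr\<close>)
  qed (use c m l in auto)
  ultimately show ?thesis by simp
qed

lemma (in ring) order_ge_64:
  assumes fin: "finite (carrier R)" and NI: "NI_ring R" and refl: "reflexive_ring R"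
    and "\<not> abelian_ring R"
  shows "64 \<le> Coset.order R"
proof -
  obtain e r where e: "e \<in> carrier R" "e \<otimes> e = e" and r: "r \<in> carrier R"
    and nc: "e \<otimes> r \<noteq> r \<otimes> e"
    using assms by (auto simp: abelian_ring_def)
  define f where "f = \<one> \<ominus> e"
  have f: "f \<in> carrier R" "f \<otimes> f = f" "e \<otimes> f = \<zero>" "f \<otimes> e = \<zero>"
    using e by (simp_all add: f_def minus_eq l_distr r_distr l_minus r_minus l_neg r_neg)
  have ef: "e \<oplus> f = \<one>" using e a_lcomm[of e \<one> "\<ominus> e"] by (simp add: f_def minus_eq r_neg)
  \<comment> \<open>If both off-diagonal components of \<open>r\<close> vanish, then
    \<open>e r = e r e = r e\<close>, contrary to the choice of \<open>r\<close>.\<close>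
  have "e \<otimes> r \<otimes> f \<noteq> \<zero> \<or> f \<otimes> r \<otimes> e \<noteq> \<zero>"
  proof (rule ccontr)
    assume "\<not> ?thesis"
    then have z: "e \<otimes> r \<otimes> f = \<zero>" "f \<otimes> r \<otimes> e = \<zero>" by auto
    have "e \<otimes> r = e \<otimes> r \<otimes> (e \<oplus> f)" using e r ef by simp
    also have "\<dots> = (e \<oplus> f) \<otimes> r \<otimes> e" using e r f(1) z by (simp add: r_distr l_distr)
    also have "\<dots> = r \<otimes> e" using ef r by simp
    finally show False using nc by simp
  qed
  then show ?thesis
    using order_ge_64_if_corner[OF fin NI refl e(1) f(1) r e(2) f(2-4)]
      order_ge_64_if_corner[OF fin NI refl f(1) e(1) r f(2) e(2) f(4,3)] by blast
qed

section \<open>The ring of order 64\<close>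

text \<open>This is multiplication of 2 by 2 matrices with rows \<open>(u, e)\<close> and
  \<open>(z, v)\<close>, where \<open>u\<close>, \<open>v\<close> act on the off-diagonal entries
  through their constant terms and a product of two off-diagonal entries is multiplied by
  \<open>x\<close>.\<close>

lemma ex_ring_mult_dual:
  "(dual a1 b1, dual c1 d1, e1, z1) \<otimes>\<^bsub>ex_ring\<^esub> (dual a2 b2, dual c2 d2, e2, z2)
     = (dual (a1 * a2) (e1 * z2 + (a1 * b2 + b1 * a2)),
        dual (c1 * c2) (e2 * z1 + (c1 * d2 + d1 * c2)),
        a1 * e2 + c2 * e1, c1 * z2 + a2 * z1)"
  by (simp add: ex_ring_mult mult_F2_dual add_F2_dual)

lemma ex_ring_one: "\<one>\<^bsub>ex_ring\<^esub> = (dual 1 0, dual 1 0, 0, 0)"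
  by (simp add: ex_ring_def one_F2_dual)

lemma ex_ring_memI [simp]: "(dual a b, dual c d, e, z) \<in> carrier ex_ring"
  by (auto simp: ex_ring_carrier)

lemma ex_ring_cases:
  assumes "p \<in> carrier ex_ring"
  obtains a b c d e z where "p = (dual a b, dual c d, e, z)"
  using assms by (auto simp: ex_ring_carrier)

lemmas ex_ring_simps =
  ex_ring_mult_dual ex_ring_add ex_ring_zero ex_ring_one dual_eq_iff

section \<open>The ring axioms, verified in coordinates\<close>

lemma ex_ring_mult_assoc:
  assumes "p \<in> carrier ex_ring" "q \<in> carrier ex_ring" "r \<in> carrier ex_ring"
  shows "p \<otimes>\<^bsub>ex_ring\<^esub> q \<otimes>\<^bsub>ex_ring\<^esub> r = p \<otimes>\<^bsub>ex_ring\<^esub> (q \<otimes>\<^bsub>ex_ring\<^esub> r)"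
proof -
  obtain a1 b1 c1 d1 e1 z1 where p: "p = (dual a1 b1, dual c1 d1, e1, z1)"
    using assms(1) by (rule ex_ring_cases)
  obtain a2 b2 c2 d2 e2 z2 where q: "q = (dual a2 b2, dual c2 d2, e2, z2)"
    using assms(2) by (rule ex_ring_cases)
  obtain a3 b3 c3 d3 e3 z3 where r: "r = (dual a3 b3, dual c3 d3, e3, z3)"
    using assms(3) by (rule ex_ring_cases)
  show ?thesis
    \<comment> \<open>Coordinatewise, both sides expand to the same sum of monomials, so no case
      distinction on bits is needed.\<close>
    unfolding p q r by (simp only: ex_ring_mult_dual distrib_left distrib_right ac_simps)
qed

lemma ex_ring_distrib:
  assumes "p \<in> carrier ex_ring" "q \<in> carrier ex_ring" "r \<in> carrier ex_ring"
  shows "(p \<oplus>\<^bsub>ex_ring\<^esub> q) \<otimes>\<^bsub>ex_ring\<^esub> r = p \<otimes>\<^bsub>ex_ring\<^esub> r \<oplus>\<^bsub>ex_ring\<^esub> q \<otimes>\<^bsub>ex_ring\<^esub> r"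
    and "r \<otimes>\<^bsub>ex_ring\<^esub> (p \<oplus>\<^bsub>ex_ring\<^esub> q) = r \<otimes>\<^bsub>ex_ring\<^esub> p \<oplus>\<^bsub>ex_ring\<^esub> r \<otimes>\<^bsub>ex_ring\<^esub> q"
proof -
  obtain a1 b1 c1 d1 e1 z1 where p: "p = (dual a1 b1, dual c1 d1, e1, z1)"
    using assms(1) by (rule ex_ring_cases)
  obtain a2 b2 c2 d2 e2 z2 where q: "q = (dual a2 b2, dual c2 d2, e2, z2)"
    using assms(2) by (rule ex_ring_cases)
  obtain a3 b3 c3 d3 e3 z3 where r: "r = (dual a3 b3, dual c3 d3, e3, z3)"
    using assms(3) by (rule ex_ring_cases)
  show "(p \<oplus>\<^bsub>ex_ring\<^esub> q) \<otimes>\<^bsub>ex_ring\<^esub> r = p \<otimes>\<^bsub>ex_ring\<^esub> r \<oplus>\<^bsub>ex_ring\<^esub> q \<otimes>\<^bsub>ex_ring\<^esub> r"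
    and "r \<otimes>\<^bsub>ex_ring\<^esub> (p \<oplus>\<^bsub>ex_ring\<^esub> q) = r \<otimes>\<^bsub>ex_ring\<^esub> p \<oplus>\<^bsub>ex_ring\<^esub> r \<otimes>\<^bsub>ex_ring\<^esub> q"
    unfolding p q r
    by (simp_all only: ex_ring_mult_dual ex_ring_add distrib_left distrib_right ac_simps)
qed

lemma abelian_group_ex_ring: "abelian_group ex_ring"
proof (rule abelian_groupI)
  fix p q r assume c: "p \<in> carrier ex_ring" "q \<in> carrier ex_ring" "r \<in> carrier ex_ring"
  obtain a1 b1 c1 d1 e1 z1 where p: "p = (dual a1 b1, dual c1 d1, e1, z1)"
    using c(1) by (rule ex_ring_cases)
  obtain a2 b2 c2 d2 e2 z2 where q: "q = (dual a2 b2, dual c2 d2, e2, z2)"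
    using c(2) by (rule ex_ring_cases)
  obtain a3 b3 c3 d3 e3 z3 where r: "r = (dual a3 b3, dual c3 d3, e3, z3)"
    using c(3) by (rule ex_ring_cases)
  show "p \<oplus>\<^bsub>ex_ring\<^esub> q \<oplus>\<^bsub>ex_ring\<^esub> r = p \<oplus>\<^bsub>ex_ring\<^esub> (q \<oplus>\<^bsub>ex_ring\<^esub> r)"
    and "p \<oplus>\<^bsub>ex_ring\<^esub> q = q \<oplus>\<^bsub>ex_ring\<^esub> p"
    unfolding p q r by (simp_all only: ex_ring_add ac_simps)
  show "p \<oplus>\<^bsub>ex_ring\<^esub> q \<in> carrier ex_ring"
    unfolding p q by (simp only: ex_ring_add ex_ring_memI)
next
  fix p assume "p \<in> carrier ex_ring"
  then obtain a b c d e z where p: "p = (dual a b, dual c d, e, z)"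
    by (rule ex_ring_cases)
  then show "\<zero>\<^bsub>ex_ring\<^esub> \<oplus>\<^bsub>ex_ring\<^esub> p = p" by (simp add: ex_ring_zero ex_ring_add)
  \<comment> \<open>In characteristic 2 each element is its own additive inverse.\<close>
  have "p \<oplus>\<^bsub>ex_ring\<^esub> p = \<zero>\<^bsub>ex_ring\<^esub>" unfolding p by (simp add: ex_ring_zero ex_ring_add)
  then show "\<exists>q\<in>carrier ex_ring. q \<oplus>\<^bsub>ex_ring\<^esub> p = \<zero>\<^bsub>ex_ring\<^esub>"
    using \<open>p \<in> carrier ex_ring\<close> by blast
qed (simp add: ex_ring_zero)

lemma monoid_ex_ring: "monoid ex_ring"
proof (rule monoidI)
  fix p q assume c: "p \<in> carrier ex_ring" "q \<in> carrier ex_ring"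
  obtain a1 b1 c1 d1 e1 z1 where p: "p = (dual a1 b1, dual c1 d1, e1, z1)"
    using c(1) by (rule ex_ring_cases)
  obtain a2 b2 c2 d2 e2 z2 where q: "q = (dual a2 b2, dual c2 d2, e2, z2)"
    using c(2) by (rule ex_ring_cases)
  show "p \<otimes>\<^bsub>ex_ring\<^esub> q \<in> carrier ex_ring"
    unfolding p q by (simp only: ex_ring_mult_dual ex_ring_memI)
  show "\<one>\<^bsub>ex_ring\<^esub> \<otimes>\<^bsub>ex_ring\<^esub> p = p" and "p \<otimes>\<^bsub>ex_ring\<^esub> \<one>\<^bsub>ex_ring\<^esub> = p"
    unfolding p by (simp_all add: ex_ring_one ex_ring_mult_dual)
qed (simp_all add: ex_ring_one ex_ring_mult_assoc)

lemma ring_ex_ring: "ring ex_ring"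
  by (rule ringI) (simp_all add: abelian_group_ex_ring monoid_ex_ring ex_ring_distrib)

interpretation ex_ring: ring ex_ring
  by (rule ring_ex_ring)

section \<open>Nilpotent elements, the NI property and reflexivity\<close>

lemma ex_ring_pow:
  "\<exists>b' d' e' z'. (dual a b, dual c d, e, z) [^]\<^bsub>ex_ring\<^esub> (n::nat)
     = (dual (a ^ n) b', dual (c ^ n) d', e', z')"
proof (induction n)
  case (Suc n)
  then show ?case by (auto simp: ex_ring_simps ac_simps)
qed (auto simp: ex_ring_simps)

text \<open>The two constant terms behave multiplicatively, with values in a field, so they vanish
  on nilpotents. Conversely, elements with both constant terms zero have cube zero.\<close>

lemma nilpotents_ex_ring:
  "nilpotents ex_ring = {(dual 0 b, dual 0 d, e, z) | b d e z. True}" (is "_ = ?N")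
proof
  show "nilpotents ex_ring \<subseteq> ?N"
  proof
    fix p assume "p \<in> nilpotents ex_ring"
    then obtain n :: nat where p: "p \<in> carrier ex_ring" "p [^]\<^bsub>ex_ring\<^esub> n = \<zero>\<^bsub>ex_ring\<^esub>"
      by (auto simp: nilpotents_def)
    then obtain a b c d e z where eq: "p = (dual a b, dual c d, e, z)"
      by (auto elim: ex_ring_cases)
    then have "a ^ n = 0" "c ^ n = 0"
      using ex_ring_pow[of a b c d e z n] p by (auto simp: ex_ring_simps)
    then show "p \<in> ?N" using eq by auto
  qed
  show "?N \<subseteq> nilpotents ex_ring"
  proof
    fix p assume "p \<in> ?N"
    \<comment> \<open>The square is \<open>(e z x, e z x, 0, 0)\<close>, which is nonzero for
      \<open>e = z = 1\<close>; one more factor with zero constant terms annihilates it.\<close>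
    then have "p [^]\<^bsub>ex_ring\<^esub> (3::nat) = \<zero>\<^bsub>ex_ring\<^esub>" "p \<in> carrier ex_ring"
      by (auto simp: ex_ring_simps numeral_3_eq_3)
    then show "p \<in> nilpotents ex_ring" unfolding nilpotents_def by blast
  qed
qed

lemma NI_ex_ring: "NI_ring ex_ring"
  unfolding NI_ring_def
proof (rule idealI[OF ring_ex_ring])
  have inv: "\<ominus>\<^bsub>ex_ring\<^esub> p = p" if "p \<in> carrier ex_ring" for p
    using that by (intro ex_ring.minus_equality) (auto simp: ex_ring_simps elim!: ex_ring_cases)
  show "subgroup (nilpotents ex_ring) (add_monoid ex_ring)"
  proof (rule ex_ring.add.subgroupI)
    fix p assume "p \<in> nilpotents ex_ring"
    then show "\<ominus>\<^bsub>ex_ring\<^esub> p \<in> nilpotents ex_ring"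
      using inv[of p] by (simp add: nilpotents_def)
  qed (auto simp: nilpotents_ex_ring ex_ring_simps)
qed (auto simp: nilpotents_ex_ring ex_ring_simps elim!: ex_ring_cases)

text \<open>Evaluating \<open>p r q\<close> at the six basis elements \<open>r\<close> yields a system of equations that is
  symmetric in \<open>p\<close> and \<open>q\<close>.\<close>
lemma ex_ring_annihilates_iff:
  "(\<forall>r\<in>carrier ex_ring. (dual a1 b1, dual c1 d1, e1, z1) \<otimes>\<^bsub>ex_ring\<^esub> r
       \<otimes>\<^bsub>ex_ring\<^esub> (dual a2 b2, dual c2 d2, e2, z2) = \<zero>\<^bsub>ex_ring\<^esub>)
   \<longleftrightarrow> a1 * a2 = 0 \<and> c1 * c2 = 0 \<and> a1 * b2 + b1 * a2 = 0 \<and> c1 * d2 + d1 * c2 = 0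
     \<and> e1 * z2 = 0 \<and> z1 * e2 = 0 \<and> a1 * c2 = 0 \<and> c1 * a2 = 0
     \<and> a1 * e2 = 0 \<and> e1 * a2 = 0 \<and> a1 * z2 = 0 \<and> z1 * a2 = 0
     \<and> c1 * e2 = 0 \<and> e1 * c2 = 0 \<and> c1 * z2 = 0 \<and> z1 * c2 = 0"
  (is "(\<forall>r\<in>_. ?P r) \<longleftrightarrow> ?E")
proof
  assume P: "\<forall>r\<in>carrier ex_ring. ?P r"
  have "?P (dual 1 0, dual 0 0, 0, 0)" "?P (dual 0 0, dual 1 0, 0, 0)"
    "?P (dual 0 1, dual 0 0, 0, 0)" "?P (dual 0 0, dual 0 1, 0, 0)"
    "?P (dual 0 0, dual 0 0, 1, 0)" "?P (dual 0 0, dual 0 0, 0, 1)"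
    using P by simp_all
  then show ?E by (simp add: ex_ring_simps) (auto simp: ac_simps)
next
  assume E: ?E
  show "\<forall>r\<in>carrier ex_ring. ?P r"
  proof
    fix r assume "r \<in> carrier ex_ring"
    then obtain a b c d e z where r: "r = (dual a b, dual c d, e, z)"
      by (rule ex_ring_cases)
    show "?P r"
      using E unfolding r
      by (cases a1; cases a2; cases c1; cases c2) (auto simp: ex_ring_simps)
  qed
qed

lemma reflexive_ex_ring: "reflexive_ring ex_ring"
  unfolding reflexive_ring_def
proof (intro ballI impI)
  fix p q r
  assume c: "p \<in> carrier ex_ring" "q \<in> carrier ex_ring" "r \<in> carrier ex_ring"
    and z: "\<forall>r\<in>carrier ex_ring. p \<otimes>\<^bsub>ex_ring\<^esub> r \<otimes>\<^bsub>ex_ring\<^esub> q = \<zero>\<^bsub>ex_ring\<^esub>"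
  from c obtain a1 b1 c1 d1 e1 z1 a2 b2 c2 d2 e2 z2
    where p: "p = (dual a1 b1, dual c1 d1, e1, z1)" and q: "q = (dual a2 b2, dual c2 d2, e2, z2)"
    by (metis ex_ring_cases)
  \<comment> \<open>Exchanging \<open>p\<close> and \<open>q\<close> permutes the equations up to
    commutativity; for instance, \<open>a1 * c2 = 0\<close> is exchanged with
    \<open>c1 * a2 = 0\<close>.\<close>
  have "\<forall>r\<in>carrier ex_ring. q \<otimes>\<^bsub>ex_ring\<^esub> r \<otimes>\<^bsub>ex_ring\<^esub> p = \<zero>\<^bsub>ex_ring\<^esub>"
    using z unfolding p q ex_ring_annihilates_iff by (simp only: ac_simps)
  then show "q \<otimes>\<^bsub>ex_ring\<^esub> r \<otimes>\<^bsub>ex_ring\<^esub> p = \<zero>\<^bsub>ex_ring\<^esub>" using c by blast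
qed

section \<open>Noncentral idempotent and order\<close>

lemma not_abelian_ex_ring: "\<not> abelian_ring ex_ring"
proof
  assume "abelian_ring ex_ring"
  \<comment> \<open>In the matrix picture this is the idempotent E11; it fails to commute with E12,
    since E11 E12 = E12 but E12 E11 = 0.\<close>
  moreover have "(dual 1 0, dual 0 0, 0, 0) \<otimes>\<^bsub>ex_ring\<^esub> (dual 1 0, dual 0 0, 0, 0)
      = (dual 1 0, dual 0 0, 0, 0)"
    by (simp add: ex_ring_simps)
  ultimately have "(dual 1 0, dual 0 0, 0, 0) \<otimes>\<^bsub>ex_ring\<^esub> (dual 0 0, dual 0 0, 1, 0)
      = (dual 0 0, dual 0 0, 1, 0) \<otimes>\<^bsub>ex_ring\<^esub> (dual 1 0, dual 0 0, 0, 0)"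
    unfolding abelian_ring_def using ex_ring_memI by blast
  then show False by (simp add: ex_ring_simps)
qed

lemma order_ex_ring: "Coset.order ex_ring = 64"
proof -
  let ?f = "\<lambda>(a, b, c, d, e, z). (dual a b, dual c d, e, z)"
  have "(UNIV :: bit set) = {0, 1}" by auto
  then have "card (UNIV :: bit set) = card {0, 1 :: bit}" by simp
  then have "card (UNIV :: bit set) = 2" by simp
  then have "card (UNIV :: (bit \<times> bit \<times> bit \<times> bit \<times> bit \<times> bit) set) = 64"
    by (simp add: UNIV_Times_UNIV[symmetric] card_cartesian_product del: UNIV_Times_UNIV)
  \<comment> \<open>Residue classes are determined by their two coefficients, so six bits
    parametrize the carrier without repetition.\<close>
  moreover have "bij_betw ?f UNIV (carrier ex_ring)"
    by (auto simp: bij_betw_def inj_on_def dual_eq_iff ex_ring_carrier image_def)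
  ultimately show ?thesis
    by (simp add: Coset.order_def bij_betw_same_card[symmetric])
qed

theorem theorem3p14:
  shows "(\<forall>S :: ('a, 'm) ring_scheme.
            ring S \<and> finite (carrier S) \<and> NI_ring S \<and> reflexive_ring S \<and> \<not> abelian_ring S
              \<longrightarrow> 64 \<le> Coset.order S) \<and>
         ring ex_ring \<and> NI_ring ex_ring \<and> reflexive_ring ex_ring \<and> \<not> abelian_ring ex_ring \<and>
         Coset.order ex_ring = 64 \<and>
         \<one>\<^bsub>ex_ring\<^esub> = (\<one>\<^bsub>F2_dual\<^esub>, \<one>\<^bsub>F2_dual\<^esub>, 0, 0)"
  using ring.order_ge_64 ring_ex_ring NI_ex_ring reflexive_ex_ring not_abelian_ex_ring
    order_ex_ring
  by (auto simp: ex_ring_one one_F2_dual)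

end
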